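(* Let $H$ be a real or complex Hilbert space, let $A$ be the generator of a $C_0$-semigroup in $H$ with domain $D(A)$, and let $I$ be the identity operator on $H$. Then the following statements are equivalent: (i) $(A, I)$ is locally passive; (ii) $A$ is dissipative, i.e. $\operatorname{Re}\langle Ax, x\rangle \leq 0$ for all $x \in D(A)$.
   Context: Let $H$ be a real or complex Hilbert space with inner product $\langle\cdot,\cdot\rangle$ (if $H$ is real, $\operatorname{Re}$ is superfluous), $A$ the generator of a $C_0$-semigroup $S$ in $H$, and $P$ a (bounded linear) projection on $H$. For $T>0$ and $u\in C([0,T],H)$, the mild solution of $\dot x(t) = Ax(t)+Pu(t)$, $x(0)=0$, is $x(t) = \int_0^t S(t-s)Pu(s)\,ds$, $t\in[0,T]$. The pair $(A,P)$ is called locally passive if for all $T>0$ and $u \in C([0,T],H)$ the mild solution $x \in C([0,T],H)$ of $\dot x(t) = Ax(t)+Pu(t)$, $x(0)=0$, satisfies $$W_T(u) := \operatorname{Re}\int_0^T \langle x(t), P u(t)\rangle\, dt \geq 0.$$ *)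

theory Defs
  imports "HOL-Analysis.Analysis"
begin

text \<open>
  Real Hilbert spaces are the types of sort \<open>{real_inner, banach}\<close>.  For complex Hilbert
  spaces we add a complex scalar multiplication and a complex inner product (linear in the first
  argument) to the underlying real Hilbert space, whose inner product is \<open>Re \<langle>x, y\<rangle>\<close>.
  Definiteness of \<open>cinner\<close>, \<open>norm x = sqrt (Re (cinner x x))\<close> and \<open>scaleC 1 x = x\<close> follow from
  the axioms linking it to \<open>inner\<close> and \<open>scaleR\<close>.
\<close>

class complex_inner = real_inner +
  fixes scaleC :: "complex \<Rightarrow> 'a \<Rightarrow> 'a"
    and cinner :: "'a \<Rightarrow> 'a \<Rightarrow> complex"
  assumes scaleC_add_right: "scaleC a (x + y) = scaleC a x + scaleC a y"
    and scaleC_add_left: "scaleC (a + b) x = scaleC a x + scaleC b x"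
    and scaleC_scaleC: "scaleC a (scaleC b x) = scaleC (a * b) x"
    and scaleR_eq_scaleC: "scaleR r x = scaleC (complex_of_real r) x"
    and cinner_commute: "cinner x y = cnj (cinner y x)"
    and cinner_add_left: "cinner (x + y) z = cinner x z + cinner y z"
    and cinner_scaleC_left: "cinner (scaleC a x) y = a * cinner x y"
    and inner_eq_Re_cinner: "inner x y = Re (cinner x y)"

class complex_hilbert_space = complex_inner + banach

instantiation complex :: complex_hilbert_space
begin

definition "scaleC_complex (a::complex) (x::complex) = a * x"
definition "cinner_complex (x::complex) (y::complex) = x * cnj y"

instance
  by standard
    (auto simp: scaleC_complex_def cinner_complex_def algebra_simps scaleR_conv_of_real
      inner_complex_def)

end

definition c0_semigroup :: "(real \<Rightarrow> 'a::real_normed_vector \<Rightarrow> 'a) \<Rightarrow> bool" where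
  "c0_semigroup S \<longleftrightarrow>
     (\<forall>t\<ge>0. bounded_linear (S t)) \<and>
     S 0 = id \<and>
     (\<forall>s\<ge>0. \<forall>t\<ge>0. S (s + t) = S s \<circ> S t) \<and>
     (\<forall>x. continuous_on {0..} (\<lambda>t. S t x))"

definition complex_c0_semigroup :: "(real \<Rightarrow> 'a::complex_inner \<Rightarrow> 'a) \<Rightarrow> bool" where
  "complex_c0_semigroup S \<longleftrightarrow>
     c0_semigroup S \<and> (\<forall>t\<ge>0. \<forall>c x. S t (scaleC c x) = scaleC c (S t x))"

text \<open>
  An unbounded operator is given by its domain \<open>D\<close> and a function \<open>A\<close> whose values outside \<open>D\<close>
  are irrelevant.
\<close>

definition is_generator ::
  "(real \<Rightarrow> 'a::real_normed_vector \<Rightarrow> 'a) \<Rightarrow> 'a set \<Rightarrow> ('a \<Rightarrow> 'a) \<Rightarrow> bool" where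
  "is_generator S D A \<longleftrightarrow>
     D = {x. \<exists>y. ((\<lambda>t. (S t x - x) /\<^sub>R t) \<longlongrightarrow> y) (at_right 0)} \<and>
     (\<forall>x\<in>D. ((\<lambda>t. (S t x - x) /\<^sub>R t) \<longlongrightarrow> A x) (at_right 0))"

definition mild_solution ::
  "(real \<Rightarrow> 'a::banach \<Rightarrow> 'a) \<Rightarrow> ('a \<Rightarrow> 'a) \<Rightarrow> (real \<Rightarrow> 'a) \<Rightarrow> real \<Rightarrow> 'a" where
  "mild_solution S P u t = integral {0..t} (\<lambda>s. S (t - s) (P (u s)))"

text \<open>
  A generator determines its semigroup uniquely, so the quantifier over \<open>S\<close> below just names the
  semigroup generated by \<open>A\<close>.
\<close>

definition locally_passive ::
  "'a::{real_inner,banach} set \<Rightarrow> ('a \<Rightarrow> 'a) \<Rightarrow> ('a \<Rightarrow> 'a) \<Rightarrow> bool" where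
  "locally_passive D A P \<longleftrightarrow>
     (\<forall>S. c0_semigroup S \<and> is_generator S D A \<longrightarrow>
       (\<forall>T>0. \<forall>u. continuous_on {0..T} u \<longrightarrow>
          integral {0..T} (\<lambda>t. inner (mild_solution S P u t) (P (u t))) \<ge> 0))"

definition complex_locally_passive ::
  "'a::complex_hilbert_space set \<Rightarrow> ('a \<Rightarrow> 'a) \<Rightarrow> ('a \<Rightarrow> 'a) \<Rightarrow> bool" where
  "complex_locally_passive D A P \<longleftrightarrow>
     (\<forall>S. complex_c0_semigroup S \<and> is_generator S D A \<longrightarrow>
       (\<forall>T>0. \<forall>u. continuous_on {0..T} u \<longrightarrow>
          Re (integral {0..T} (\<lambda>t. cinner (mild_solution S P u t) (P (u t)))) \<ge> 0))"

definition dissipative :: "'a::real_inner set \<Rightarrow> ('a \<Rightarrow> 'a) \<Rightarrow> bool" where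
  "dissipative D A \<longleftrightarrow> (\<forall>x\<in>D. inner (A x) x \<le> 0)"

definition complex_dissipative :: "'a::complex_inner set \<Rightarrow> ('a \<Rightarrow> 'a) \<Rightarrow> bool" where
  "complex_dissipative D A \<longleftrightarrow> (\<forall>x\<in>D. Re (cinner (A x) x) \<le> 0)"

end

theory Submission
  imports Defs
begin

text \<open>
  Dissipativity and passivity are linked by the energy balance of the controlled equation: with
  \<open>P = I\<close> and a classical solution \<open>x\<close>, the derivative of \<open>\<parallel>x\<parallel>\<^sup>2 / 2\<close> is
  \<open>Re \<langle>Ax, x\<rangle> + Re \<langle>u, x\<rangle>\<close>.

  Passivity is tested on trajectories \<open>x(t) = \<phi>(t) v\<close> with \<open>v\<close> in the domain and \<open>\<phi>(0) = 0\<close>,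
  which the control \<open>u = \<phi>' v - \<phi> A v\<close> produces.  If also \<open>\<phi>(T) = 0\<close>, the
  term \<open>\<integral> \<phi> \<phi>' \<parallel>v\<parallel>\<^sup>2\<close> vanishes and the supplied energy is \<open>- Re \<langle>A v, v\<rangle> \<integral> \<phi>\<^sup>2\<close>; its
  nonnegativity is dissipativity at \<open>v\<close>.  The choice \<open>\<phi>(t) = t (1 - t)\<close> on \<open>[0, 1]\<close> gives
  \<open>\<integral> \<phi>\<^sup>2 = 1/30\<close> (lemmas \<open>mild_solution_bump\<close> and \<open>bump_energy\<close>).

  If \<open>A\<close> is dissipative, the semigroup consists of contractions (\<open>dissipative_imp_contraction\<close>).
  For a general continuous \<open>u\<close> the mild solution need not be differentiable, nor take values in the
  domain, but the balance survives as an inequality: \<open>x(t + h)\<close> is \<open>S(h) x(t)\<close> plus the integral of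
  \<open>S(t + h - s) u(s)\<close> over \<open>[t, t + h]\<close>, and after expanding the square
  \<open>\<parallel>S(h) x(t)\<parallel> \<le> \<parallel>x(t)\<parallel>\<close> bounds the upper right Dini derivative of \<open>\<parallel>x\<parallel>\<^sup>2\<close> by \<open>2 Re \<langle>x, u\<rangle>\<close>.  Hence \<open>\<parallel>x(T)\<parallel>\<^sup>2 \<le> 2 W\<^sub>T(u)\<close>
  (\<open>contraction_energy_inequality\<close>).

  Semigroups give one-sided difference quotients for free, so all monotonicity and uniqueness arguments
  run through one lemma on upper right Dini derivatives.  The complex case reduces to the real one
  because the real part of the complex inner product is the inner product of the underlying real
  Hilbert space.
\<close>

section \<open>Upper right Dini derivatives\<close>

lemma eventually_at_right_0_less:
  fixes d :: real
  shows "d > 0 \<Longrightarrow> \<forall>\<^sub>F h in at_right 0. h < d"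
  by (intro eventually_at_rightI[of 0 d]) auto

text \<open>
  The difference quotient of \<open>f\<close> at \<open>x\<close> is only bounded from above, by a function \<open>q\<close> with limit
  \<open>d \<le> 0\<close>; this is the form in which energy estimates arrive.  If the claim failed, \<open>f\<close> would climb
  above a line of small positive slope \<open>e\<close> through \<open>(a, f a)\<close>; at the last point on or below this line,
  the bound on the quotient lets one go further to the right and stay on or below it.
\<close>

lemma nonincreasing_if_upper_right_derivative_nonpos:
  fixes f :: "real \<Rightarrow> real"
  assumes ab: "a \<le> b" and cont: "continuous_on {a..b} f"
    and deriv: "\<And>x. a \<le> x \<Longrightarrow> x < b \<Longrightarrow>
      \<exists>d q. d \<le> 0 \<and> (q \<longlongrightarrow> d) (at_right 0) \<and> (\<forall>\<^sub>F h in at_right 0. f (x + h) \<le> f x + h * q h)"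
  shows "f b \<le> f a"
proof (rule ccontr)
  assume "\<not> f b \<le> f a"
  hence lt: "f a < f b" by simp
  with ab have ab': "a < b" by (cases "a = b") auto
  \<comment> \<open>Half the slope of the chord, so that \<open>b\<close> itself lies above the line.\<close>
  define e where "e = (f b - f a) / (2 * (b - a))"
  have e0: "e > 0" using lt ab' by (simp add: e_def)
  have eb: "e * (b - a) = (f b - f a) / 2" using ab' by (simp add: e_def field_simps)
  define Z where "Z = {x \<in> {a..b}. f x \<le> f a + e * (x - a)}"
  have "closed Z" unfolding Z_def
    by (intro closed_Collect_le[OF continuous_on_subset] continuous_on_closed_Collect_le cont continuous_intros closed_atLeastAtMost)
  have aZ: "a \<in> Z" using ab by (simp add: Z_def)
  have bdd: "bdd_above Z" unfolding Z_def by (rule bdd_aboveI[of _ b]) auto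
  define c where "c = Sup Z"
  have cZ: "c \<in> Z" unfolding c_def
    using closed_contains_Sup[OF _ bdd \<open>closed Z\<close>] aZ by auto
  have "b \<notin> Z" using eb lt by (simp add: Z_def)
  with cZ have c: "a \<le> c" "c < b" "f c \<le> f a + e * (c - a)"
    by (auto simp: Z_def less_eq_real_def)
  obtain d q where dq: "d \<le> 0" "(q \<longlongrightarrow> d) (at_right 0)"
      "\<forall>\<^sub>F h in at_right 0. f (c + h) \<le> f c + h * q h"
    using deriv[OF c(1,2)] by auto
  have "\<forall>\<^sub>F h in at_right 0. q h < e"
    using order_tendstoD(2)[OF dq(2)] dq(1) e0 by simp
  moreover have "\<forall>\<^sub>F h in at_right 0. h < b - c"
    using c(2) by (intro eventually_at_right_0_less) simp
  moreover have "\<forall>\<^sub>F h in at_right (0::real). h > 0"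
    by (rule eventually_at_right_less)
  ultimately have "\<forall>\<^sub>F h in at_right 0. c + h \<in> Z \<and> h > 0"
    using dq(3)
  proof eventually_elim
    case (elim h)
    have "h * q h \<le> h * e" using elim by (intro mult_left_mono) auto
    hence "f (c + h) \<le> f a + e * (c + h - a)"
      using elim(4) c(3) by (simp add: algebra_simps)
    thus ?case using elim c by (simp add: Z_def)
  qed
  then obtain h where "c + h \<in> Z" "h > 0"
    using eventually_happens[of _ "at_right (0::real)"] by auto
  thus False using cSup_upper[of "c + h" Z] bdd by (simp add: c_def)
qed

section \<open>Orbits of a semigroup\<close>

lemma c0_semigroupD:
  assumes "c0_semigroup S"
  shows c0_linear: "t \<ge> 0 \<Longrightarrow> bounded_linear (S t)"
    and c0_zero: "S 0 x = x"
    and c0_add: "s \<ge> 0 \<Longrightarrow> t \<ge> 0 \<Longrightarrow> S (s + t) x = S s (S t x)"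
    and c0_orbit_continuous: "continuous_on {0..} (\<lambda>t. S t x)"
  using assms by (auto simp: c0_semigroup_def)

lemma orbit_tendsto_at_0:
  assumes "c0_semigroup S"
  shows "((\<lambda>h. S h x) \<longlongrightarrow> x) (at_right 0)"
proof -
  have "((\<lambda>h. S h x) \<longlongrightarrow> S 0 x) (at 0 within {0..})"
    using c0_orbit_continuous[OF assms, of x] by (auto simp: continuous_on_def)
  thus ?thesis using c0_zero[OF assms]
    by (metis atLeast_iff filterlim_mono greaterThan_iff less_eq_real_def order_refl at_le subsetI)
qed

text \<open>
  The integrand may change with the length of the interval: in a mild solution, the step from \<open>t\<close>
  to \<open>t + h\<close> has the integrand \<open>S (t + h - s) (u s)\<close>.
\<close>

lemma average_tendsto_if_near:
  fixes f :: "real \<Rightarrow> real \<Rightarrow> 'a::banach"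
  assumes int: "\<forall>\<^sub>F h in at_right 0. f h integrable_on {r..r+h}"
    and near: "\<And>e. e > 0 \<Longrightarrow> \<forall>\<^sub>F h in at_right 0. \<forall>s\<in>{r..r+h}. norm (f h s - y) \<le> e"
  shows "((\<lambda>h. integral {r..r+h} (f h) /\<^sub>R h) \<longlongrightarrow> y) (at_right 0)"
proof (rule tendstoI)
  fix e :: real assume e: "e > 0"
  have "\<forall>\<^sub>F h in at_right 0. \<forall>s\<in>{r..r+h}. norm (f h s - y) \<le> e / 2"
    by (rule near) (use e in simp)
  with int show "\<forall>\<^sub>F h in at_right 0. dist (integral {r..r+h} (f h) /\<^sub>R h) y < e"
    using eventually_at_right_less[of 0]
  proof eventually_elim
    case (elim h)
    have "((\<lambda>s. f h s - y) has_integral integral {r..r+h} (f h) - h *\<^sub>R y) {r..r+h}"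
      using has_integral_diff[OF integrable_integral[OF elim(1)] has_integral_const_real[of y r "r+h"]] elim
      by simp
    hence "norm (integral {r..r+h} (f h) - h *\<^sub>R y) \<le> e / 2 * h"
      using has_integral_bound_real[of "e / 2" "{}" "\<lambda>s. f h s - y" _ r "r+h"] elim e by simp
    hence "norm (integral {r..r+h} (f h) - h *\<^sub>R y) / h \<le> e / 2"
      using elim(3) by (simp only: pos_divide_le_eq)
    moreover have "integral {r..r+h} (f h) /\<^sub>R h - y = (integral {r..r+h} (f h) - h *\<^sub>R y) /\<^sub>R h"
      using elim(3) by (simp add: scaleR_diff_right)
    hence "dist (integral {r..r+h} (f h) /\<^sub>R h) y = norm (integral {r..r+h} (f h) - h *\<^sub>R y) / h"
      using elim(3) by (simp only: dist_norm norm_scaleR) (simp add: divide_inverse_commute)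
    ultimately have "dist (integral {r..r+h} (f h) /\<^sub>R h) y \<le> e / 2" by simp
    thus ?case using e by simp
  qed
qed

lemma average_tendsto:
  fixes f :: "real \<Rightarrow> 'a::banach"
  assumes cont: "continuous_on {a..b} f" and r: "a \<le> r" "r < b"
  shows "((\<lambda>h. integral {r..r+h} f /\<^sub>R h) \<longlongrightarrow> f r) (at_right 0)"
proof (rule average_tendsto_if_near)
  show "\<forall>\<^sub>F h in at_right 0. f integrable_on {r..r+h}"
    using eventually_at_right_0_less[of "b - r"] r
    by (auto elim!: eventually_mono intro!: integrable_continuous_real continuous_on_subset[OF cont])
  fix e :: real assume "e > 0"
  then obtain d where d: "d > 0" "\<And>s. s \<in> {a..b} \<Longrightarrow> dist s r < d \<Longrightarrow> dist (f s) (f r) < e"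
    using cont r unfolding continuous_on_iff by (meson atLeastAtMost_iff less_imp_le)
  have "\<forall>\<^sub>F h in at_right 0. h < d" "\<forall>\<^sub>F h in at_right 0. h < b - r"
    using d(1) r by (auto intro: eventually_at_right_0_less)
  thus "\<forall>\<^sub>F h in at_right 0. \<forall>s\<in>{r..r+h}. norm (f s - f r) \<le> e"
  proof (eventually_elim, intro ballI)
    case (elim h)
    fix s assume "s \<in> {r..r+h}"
    hence "dist (f s) (f r) < e"
      using d(2)[of s] elim r by (auto simp: dist_real_def)
    thus "norm (f s - f r) \<le> e" by (simp add: dist_norm)
  qed
qed

lemma orbit_right_difference_quotient:
  assumes S: "c0_semigroup S" and G: "is_generator S D A" and v: "v \<in> D" and r: "r \<ge> 0"
  shows "((\<lambda>h. (S (r + h) v - S r v) /\<^sub>R h) \<longlongrightarrow> S r (A v)) (at_right 0)"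
proof -
  have "((\<lambda>h. (S h v - v) /\<^sub>R h) \<longlongrightarrow> A v) (at_right 0)"
    using G v by (auto simp: is_generator_def)
  hence "((\<lambda>h. S r ((S h v - v) /\<^sub>R h)) \<longlongrightarrow> S r (A v)) (at_right 0)"
    by (rule bounded_linear.tendsto[OF c0_linear[OF S r]])
  moreover have "\<forall>\<^sub>F h in at_right 0. S r ((S h v - v) /\<^sub>R h) = (S (r + h) v - S r v) /\<^sub>R h"
    using eventually_at_right_less[of 0]
  proof eventually_elim
    case (elim h)
    interpret bounded_linear "S r" by (rule c0_linear[OF S r])
    show ?case using elim r by (simp add: scaleR diff c0_add[OF S])
  qed
  ultimately show ?thesis by (rule Lim_transform_eventually)
qed

lemma orbit_stays_in_domain:
  assumes S: "c0_semigroup S" and G: "is_generator S D A" and v: "v \<in> D" and r: "r \<ge> 0"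
  shows "S r v \<in> D" and "A (S r v) = S r (A v)"
proof -
  have "((\<lambda>h. (S (r + h) v - S r v) /\<^sub>R h) \<longlongrightarrow> S r (A v)) (at_right 0)"
    by (rule orbit_right_difference_quotient[OF S G v r])
  moreover have "\<forall>\<^sub>F h in at_right 0. (S (r + h) v - S r v) /\<^sub>R h = (S h (S r v) - S r v) /\<^sub>R h"
    using eventually_at_right_less[of 0]
    by eventually_elim (use r in \<open>simp add: c0_add[OF S] add.commute[of r]\<close>)
  ultimately have *: "((\<lambda>h. (S h (S r v) - S r v) /\<^sub>R h) \<longlongrightarrow> S r (A v)) (at_right 0)"
    by (rule Lim_transform_eventually)
  thus D: "S r v \<in> D" using G by (auto simp: is_generator_def)
  have "((\<lambda>h. (S h (S r v) - S r v) /\<^sub>R h) \<longlongrightarrow> A (S r v)) (at_right 0)"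
    using G D by (auto simp: is_generator_def)
  thus "A (S r v) = S r (A v)" using * tendsto_unique trivial_limit_at_right_real by blast
qed

text \<open>
  The two sides have the same right derivative.  Testing their difference \<open>g\<close> against the fixed
  vector \<open>g t\<close> turns this into a scalar statement, in which the Dini lemma gives
  \<open>\<parallel>g t\<parallel>\<^sup>2 \<le> 0\<close>.  The integral on the right is differentiable from both sides, which makes the
  orbit continuously differentiable without a uniform bound on the operators \<open>S t\<close>.
\<close>

lemma orbit_eq_integral:
  fixes S :: "real \<Rightarrow> 'a::{real_inner,banach} \<Rightarrow> 'a"
  assumes S: "c0_semigroup S" and G: "is_generator S D A" and v: "v \<in> D" and t: "t \<ge> 0"
  shows "S t v = v + integral {0..t} (\<lambda>s. S s (A v))"
proof -
  define g where "g r = S r v - v - integral {0..r} (\<lambda>s. S s (A v))" for r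
  have cont: "continuous_on {0..} (\<lambda>s. S s (A v))" by (rule c0_orbit_continuous[OF S])
  have int: "(\<lambda>s. S s (A v)) integrable_on {a..b}" if "0 \<le> a" for a b
    using that by (intro integrable_continuous_real continuous_on_subset[OF cont]) auto
  have gcont: "continuous_on {0..t} g" unfolding g_def
    by (intro continuous_intros indefinite_integral_continuous_1 int continuous_on_subset[OF c0_orbit_continuous[OF S]]) auto
  have "g t \<bullet> g t \<le> g 0 \<bullet> g t"
  proof (rule nonincreasing_if_upper_right_derivative_nonpos[OF t])
    show "continuous_on {0..t} (\<lambda>r. g r \<bullet> g t)" by (intro continuous_intros gcont)
    fix r assume r: "0 \<le> r" "r < t"
    define q where "q h = ((S (r + h) v - S r v) /\<^sub>R h - integral {r..r+h} (\<lambda>s. S s (A v)) /\<^sub>R h) \<bullet> g t" for h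
    have "(q \<longlongrightarrow> (S r (A v) - S r (A v)) \<bullet> g t) (at_right 0)"
      unfolding q_def by (intro tendsto_intros orbit_right_difference_quotient[OF S G v r(1)]
          average_tendsto[OF continuous_on_subset[OF cont], of 0 t] r) auto
    moreover have "\<forall>\<^sub>F h in at_right 0. g (r + h) \<bullet> g t \<le> g r \<bullet> g t + h * q h"
      using eventually_at_right_less[of 0]
    proof eventually_elim
      case (elim h)
      have "integral {0..r} (\<lambda>s. S s (A v)) + integral {r..r+h} (\<lambda>s. S s (A v)) = integral {0..r+h} (\<lambda>s. S s (A v))"
        by (rule Henstock_Kurzweil_Integration.integral_combine) (use r elim int in auto)
      hence "g (r + h) - g r = h *\<^sub>R ((S (r + h) v - S r v) /\<^sub>R h - integral {r..r+h} (\<lambda>s. S s (A v)) /\<^sub>R h)"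
        using elim by (simp add: g_def scaleR_diff_right algebra_simps)
      hence "(g (r + h) - g r) \<bullet> g t = h * q h" by (simp add: q_def)
      thus ?case by (simp add: inner_diff_left)
    qed
    ultimately show "\<exists>d q. d \<le> 0 \<and> (q \<longlongrightarrow> d) (at_right 0) \<and>
        (\<forall>\<^sub>F h in at_right 0. g (r + h) \<bullet> g t \<le> g r \<bullet> g t + h * q h)"
      by (intro exI[of _ 0] exI[of _ q]) simp
  qed
  moreover have "g 0 = 0" by (simp add: g_def c0_zero[OF S])
  ultimately have "g t = 0" by (metis inner_zero_left inner_gt_zero_iff not_less)
  thus ?thesis by (simp add: g_def algebra_simps)
qed

lemma orbit_has_vector_derivative:
  fixes S :: "real \<Rightarrow> 'a::{real_inner,banach} \<Rightarrow> 'a"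
  assumes S: "c0_semigroup S" and G: "is_generator S D A" and v: "v \<in> D" and r: "r \<in> {0..t}"
  shows "((\<lambda>s. S s v) has_vector_derivative S r (A v)) (at r within {0..t})"
proof -
  have "((\<lambda>s. integral {0..s} (\<lambda>s. S s (A v))) has_vector_derivative S r (A v)) (at r within {0..t})"
    by (rule integral_has_vector_derivative)
      (use r in \<open>auto intro: continuous_on_subset[OF c0_orbit_continuous[OF S]]\<close>)
  hence "((\<lambda>s. v + integral {0..s} (\<lambda>s. S s (A v))) has_vector_derivative 0 + S r (A v)) (at r within {0..t})"
    by (intro has_vector_derivative_add has_vector_derivative_const)
  hence "((\<lambda>s. v + integral {0..s} (\<lambda>s. S s (A v))) has_vector_derivative S r (A v)) (at r within {0..t})"
    by simp
  thus ?thesis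
    by (rule has_vector_derivative_transform[OF r, rotated]) (simp add: orbit_eq_integral[OF S G v])
qed

section \<open>From passivity to dissipativity\<close>

text \<open>
  For \<open>\<phi>(s) = s (1 - s)\<close> the control is \<open>\<phi>' v - \<phi> A v\<close>, so that the integrand of the mild solution
  is the derivative of \<open>\<phi>(s) S(t - s) v\<close> with respect to \<open>s\<close>.
\<close>

lemma mild_solution_bump:
  fixes S :: "real \<Rightarrow> 'a::{real_inner,banach} \<Rightarrow> 'a"
  assumes S: "c0_semigroup S" and G: "is_generator S D A" and v: "v \<in> D" and t: "t \<ge> 0"
  shows "mild_solution S id (\<lambda>s. (1 - 2 * s) *\<^sub>R v - (s * (1 - s)) *\<^sub>R A v) t = (t * (1 - t)) *\<^sub>R v"
proof -
  define F where "F s = (s * (1 - s)) *\<^sub>R S (t - s) v" for s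
  have "((\<lambda>s. S (t - s) (id ((1 - 2 * s) *\<^sub>R v - (s * (1 - s)) *\<^sub>R A v))) has_integral F t - F 0) {0..t}"
  proof (rule fundamental_theorem_of_calculus[OF t])
    fix s assume s: "s \<in> {0..t}"
    interpret bounded_linear "S (t - s)" using s by (intro c0_linear[OF S]) auto
    have 1: "((\<lambda>s. t - s) has_vector_derivative -1) (at s within {0..t})"
      by (auto intro!: derivative_eq_intros)
    have "(\<lambda>s. t - s) ` {0..t} = {0..t}"
      by (auto simp: image_iff intro!: bexI[of _ "t - _"])
    hence "((\<lambda>r. S r v) has_vector_derivative S (t - s) (A v)) (at (t - s) within (\<lambda>s. t - s) ` {0..t})"
      using orbit_has_vector_derivative[OF S G v, of "t - s" t] s by simp
    from vector_diff_chain_within[OF 1 this]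
    have 2: "((\<lambda>s. S (t - s) v) has_vector_derivative - S (t - s) (A v)) (at s within {0..t})"
      by (simp add: o_def)
    have 3: "((\<lambda>s. s * (1 - s)) has_real_derivative 1 - 2 * s) (at s within {0..t})"
      by (auto intro!: derivative_eq_intros)
    have "(F has_vector_derivative (s * (1 - s)) *\<^sub>R (- S (t - s) (A v)) + (1 - 2 * s) *\<^sub>R S (t - s) v) (at s within {0..t})"
      unfolding F_def by (rule has_vector_derivative_scaleR[OF 3 2])
    thus "(F has_vector_derivative S (t - s) (id ((1 - 2 * s) *\<^sub>R v - (s * (1 - s)) *\<^sub>R A v))) (at s within {0..t})"
      by (simp add: diff scaleR)
  qed
  thus ?thesis unfolding mild_solution_def by (simp add: F_def c0_zero[OF S] integral_unique)
qed

text \<open>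
  The integrand is \<open>\<phi> \<phi>' \<parallel>v\<parallel>\<^sup>2 - \<phi>\<^sup>2 \<langle>A v, v\<rangle>\<close>.  The first term integrates to zero
  because \<open>\<phi>\<close> vanishes at both ends, and \<open>\<integral> \<phi>\<^sup>2 = 1/3 - 1/2 + 1/5 = 1/30\<close>.
\<close>

lemma bump_energy:
  fixes S :: "real \<Rightarrow> 'a::{real_inner,banach} \<Rightarrow> 'a"
  assumes S: "c0_semigroup S" and G: "is_generator S D A" and v: "v \<in> D"
  defines "u \<equiv> \<lambda>s. (1 - 2 * s) *\<^sub>R v - (s * (1 - s)) *\<^sub>R A v"
  shows "integral {0..1} (\<lambda>t. mild_solution S id u t \<bullet> id (u t)) = - (A v \<bullet> v) / 30"
proof -
  define F where "F s = (s * (1 - s))\<^sup>2 / 2 * (v \<bullet> v) - (s^3 / 3 - s^4 / 2 + s^5 / 5) * (A v \<bullet> v)" for s :: real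
  have "((\<lambda>t. mild_solution S id u t \<bullet> id (u t)) has_integral F 1 - F 0) {0..1}"
  proof (rule fundamental_theorem_of_calculus)
    fix s :: real assume s: "s \<in> {0..1}"
    have "(F has_real_derivative (s * (1 - s)) * ((1 - 2 * s) * (v \<bullet> v) - (s * (1 - s)) * (A v \<bullet> v))) (at s within {0..1})"
      unfolding F_def by (rule derivative_eq_intros refl | simp)+ (simp add: field_simps power2_eq_square power3_eq_cube power4_eq_xxxx)
    moreover have "mild_solution S id u s \<bullet> id (u s) = (s * (1 - s)) * ((1 - 2 * s) * (v \<bullet> v) - (s * (1 - s)) * (A v \<bullet> v))"
      using s mild_solution_bump[OF S G v, of s]
      by (simp add: u_def inner_diff_right inner_commute right_diff_distrib mult.left_commute mult.assoc)
    ultimately show "(F has_vector_derivative mild_solution S id u s \<bullet> id (u s)) (at s within {0..1})"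
      by (simp add: has_real_derivative_iff_has_vector_derivative)
  qed simp
  thus ?thesis by (simp add: F_def integral_unique)
qed

section \<open>From dissipativity to contractivity\<close>

text \<open>
  The averages of an orbit over \<open>[0, h]\<close> tend to its initial value \<open>x\<close> and lie in the domain: applying
  \<open>S k\<close> shifts the interval of integration, so the difference quotient of the semigroup at the
  average involves only the two ends and tends to \<open>(S h x - x) / h\<close>.
\<close>

lemma domain_dense:
  fixes S :: "real \<Rightarrow> 'a::banach \<Rightarrow> 'a"
  assumes S: "c0_semigroup S" and G: "is_generator S D A"
  shows "closure D = UNIV"
proof -
  have "x \<in> closure D" for x
  proof -
    have cont: "continuous_on {0..} (\<lambda>s. S s x)" by (rule c0_orbit_continuous[OF S])
    have int: "(\<lambda>s. S s x) integrable_on {a..b}" if "0 \<le> a" for a b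
      using that by (intro integrable_continuous_real continuous_on_subset[OF cont]) auto
    define m where "m h = integral {0..h} (\<lambda>s. S s x)" for h
    have comb: "m (a + b) = m a + integral {a..a+b} (\<lambda>s. S s x)" if "a \<ge> 0" "b \<ge> 0" for a b
      unfolding m_def
      by (rule Henstock_Kurzweil_Integration.integral_combine[symmetric]) (use that int in auto)
    have mD: "m h /\<^sub>R h \<in> D" if h: "h > 0" for h
    proof -
      have "((\<lambda>k. (integral {h..h+k} (\<lambda>s. S s x) /\<^sub>R k - integral {0..0+k} (\<lambda>s. S s x) /\<^sub>R k) /\<^sub>R h)
          \<longlongrightarrow> (S h x - S 0 x) /\<^sub>R h) (at_right 0)"
        using h by (intro tendsto_intros average_tendsto[OF continuous_on_subset[OF cont], of 0 "h + 1"]) auto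
      moreover have "\<forall>\<^sub>F k in at_right 0. (integral {h..h+k} (\<lambda>s. S s x) /\<^sub>R k - integral {0..0+k} (\<lambda>s. S s x) /\<^sub>R k) /\<^sub>R h
          = (S k (m h /\<^sub>R h) - m h /\<^sub>R h) /\<^sub>R k"
        using eventually_at_right_less[of 0]
      proof eventually_elim
        case (elim k)
        interpret bounded_linear "S k" using elim by (intro c0_linear[OF S]) auto
        have "S k (m h) = integral {0..h} (S k \<circ> (\<lambda>s. S s x))"
          unfolding m_def by (rule integral_linear[symmetric]) (use int bounded_linear_axioms in auto)
        also have "\<dots> = integral {0..h} (\<lambda>s. S (s + k) x)"
          by (rule integral_cong) (use elim in \<open>simp add: c0_add[OF S, symmetric] add.commute\<close>)
        also have "\<dots> = integral {k..h+k} (\<lambda>s. S s x)"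
          using integral_shift_Icc_real[of 0 h "\<lambda>s. S s x" k] by (simp add: o_def add.commute)
        also have "\<dots> = m (k + h) - m k" using comb[of k h] elim h by (simp add: add.commute)
        also have "m (k + h) = m h + integral {h..h+k} (\<lambda>s. S s x)" using comb[of h k] elim h by (simp add: add.commute)
        finally have "S k (m h) - m h = integral {h..h+k} (\<lambda>s. S s x) - m k" by simp
        hence "(S k (m h) - m h) /\<^sub>R k /\<^sub>R h = (integral {h..h+k} (\<lambda>s. S s x) - m k) /\<^sub>R k /\<^sub>R h" by simp
        thus ?case by (simp add: scaleR m_def scaleR_diff_right mult.commute)
      qed
      ultimately have "((\<lambda>k. (S k (m h /\<^sub>R h) - m h /\<^sub>R h) /\<^sub>R k) \<longlongrightarrow> (S h x - S 0 x) /\<^sub>R h) (at_right 0)"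
        by (rule Lim_transform_eventually)
      thus ?thesis using G by (auto simp: is_generator_def)
    qed
    have "((\<lambda>h. m h /\<^sub>R h) \<longlongrightarrow> x) (at_right 0)"
      using average_tendsto[OF continuous_on_subset[OF cont], of 0 1 0] by (simp add: m_def c0_zero[OF S])
    moreover have "\<forall>\<^sub>F h in at_right 0. m h /\<^sub>R h \<in> closure D"
      using eventually_at_right_less[of 0] by eventually_elim (use mD closure_subset in auto)
    ultimately show ?thesis
      by (intro Lim_in_closed_set[of "closure D" _ "at_right (0::real)"]) auto
  qed
  thus ?thesis by auto
qed

text \<open>
  For \<open>v\<close> in the domain, the right derivative of \<open>\<parallel>S r v\<parallel>\<^sup>2\<close> is
  \<open>2 \<langle>A (S r v), S r v\<rangle> \<le> 0\<close>.  Density of the domain extends the bound to all vectors.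
\<close>

lemma dissipative_imp_contraction:
  fixes S :: "real \<Rightarrow> 'a::{real_inner,banach} \<Rightarrow> 'a"
  assumes S: "c0_semigroup S" and G: "is_generator S D A" and diss: "dissipative D A"
    and t: "t \<ge> 0"
  shows "norm (S t x) \<le> norm x"
proof -
  have D: "norm (S t v) \<le> norm v" if v: "v \<in> D" for v
  proof -
    have "S t v \<bullet> S t v \<le> S 0 v \<bullet> S 0 v"
    proof (rule nonincreasing_if_upper_right_derivative_nonpos[OF t])
      show "continuous_on {0..t} (\<lambda>r. S r v \<bullet> S r v)"
        by (intro continuous_intros continuous_on_subset[OF c0_orbit_continuous[OF S]]) auto
      fix r assume r: "0 \<le> r" "r < t"
      define d where "d h = (S (r + h) v - S r v) /\<^sub>R h" for h
      have d: "(d \<longlongrightarrow> S r (A v)) (at_right 0)"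
        unfolding d_def by (rule orbit_right_difference_quotient[OF S G v r(1)])
      define q where "q h = 2 * (d h \<bullet> S r v) + h * (d h \<bullet> d h)" for h
      have "(q \<longlongrightarrow> 2 * (S r (A v) \<bullet> S r v) + 0 * (S r (A v) \<bullet> S r (A v))) (at_right 0)"
        unfolding q_def by (intro tendsto_intros d)
      moreover have "S r (A v) \<bullet> S r v \<le> 0"
        using diss orbit_stays_in_domain[OF S G v r(1)] by (auto simp: dissipative_def)
      moreover have "\<forall>\<^sub>F h in at_right 0. S (r + h) v \<bullet> S (r + h) v \<le> S r v \<bullet> S r v + h * q h"
        using eventually_at_right_less[of 0]
      proof eventually_elim
        case (elim h)
        have "S (r + h) v = S r v + h *\<^sub>R d h" using elim by (simp add: d_def)
        thus ?case by (simp add: q_def inner_add_left inner_add_right inner_commute algebra_simps)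
      qed
      ultimately show "\<exists>d q. d \<le> 0 \<and> (q \<longlongrightarrow> d) (at_right 0) \<and>
          (\<forall>\<^sub>F h in at_right 0. S (r + h) v \<bullet> S (r + h) v \<le> S r v \<bullet> S r v + h * q h)"
        by (intro exI[of _ "2 * (S r (A v) \<bullet> S r v)"] exI[of _ q]) simp
    qed
    thus ?thesis by (simp add: c0_zero[OF S] norm_le)
  qed
  have "continuous_on UNIV (S t)"
    using c0_linear[OF S t] by (rule linear_continuous_on)
  hence "closed {x. norm (S t x) \<le> norm x}"
    by (intro closed_Collect_le continuous_intros)
  hence "closure D \<subseteq> {x. norm (S t x) \<le> norm x}"
    by (intro closure_minimal) (use D in auto)
  thus ?thesis using domain_dense[OF S G] by auto
qed

section \<open>Energy balance of a contraction semigroup\<close>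

lemma contraction_jointly_continuous:
  fixes S :: "real \<Rightarrow> 'a::real_normed_vector \<Rightarrow> 'a"
  assumes S: "c0_semigroup S" and C: "\<And>t x. t \<ge> 0 \<Longrightarrow> norm (S t x) \<le> norm x"
  shows "continuous_on ({0..} \<times> UNIV) (\<lambda>(r, y). S r y)"
  unfolding continuous_on_def
proof (clarify)
  fix r :: real and y :: 'a assume r: "r \<ge> 0"
  let ?F = "at (r, y) within {0..} \<times> UNIV"
  have 1: "((\<lambda>p. S (fst p) y) \<longlongrightarrow> S r y) ?F"
  proof -
    have "continuous_on ({0..} \<times> (UNIV :: 'a set)) (\<lambda>p. S (fst p) y)"
    proof (rule continuous_on_compose2[OF c0_orbit_continuous[OF S, of y]])
      show "continuous_on ({0..} \<times> (UNIV :: 'a set)) (fst :: real \<times> 'a \<Rightarrow> real)"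
        by (intro continuous_on_fst continuous_on_id)
    qed auto
    hence "((\<lambda>p. S (fst p) y) \<longlongrightarrow> S (fst (r, y)) y) ?F"
      unfolding continuous_on_def by (rule bspec) (use r in simp)
    thus ?thesis by simp
  qed
  have "((\<lambda>p. norm (snd p - y) + norm (S (fst p) y - S r y)) \<longlongrightarrow> norm (y - y) + norm (S r y - S r y)) ?F"
  proof (intro tendsto_intros 1)
    show "(snd \<longlongrightarrow> y) ?F" using tendsto_snd[OF tendsto_ident_at, of "(r, y)"] by simp
  qed
  hence 2: "((\<lambda>p. norm (snd p - y) + norm (S (fst p) y - S r y)) \<longlongrightarrow> 0) ?F" by simp
  have "((\<lambda>p. S (fst p) (snd p) - S r y) \<longlongrightarrow> 0) ?F"
  proof (rule Lim_null_comparison[OF _ 2])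
    have "norm (S (fst p) (snd p) - S r y) \<le> norm (snd p - y) + norm (S (fst p) y - S r y)" if "fst p \<ge> 0" for p
    proof -
      interpret bounded_linear "S (fst p)" using that by (rule c0_linear[OF S])
      have "S (fst p) (snd p) - S r y = S (fst p) (snd p - y) + (S (fst p) y - S r y)" by (simp add: diff)
      also have "norm \<dots> \<le> norm (snd p - y) + norm (S (fst p) y - S r y)"
        by (rule norm_triangle_mono[OF C[OF that] order_refl])
      finally show ?thesis .
    qed
    thus "\<forall>\<^sub>F p in ?F. norm (S (fst p) (snd p) - S r y) \<le> norm (snd p - y) + norm (S (fst p) y - S r y)"
      by (auto simp: eventually_at_filter intro!: always_eventually)
  qed
  thus "((\<lambda>(r, y). S r y) \<longlongrightarrow> S r y) ?F"
    by (subst (asm) LIM_zero_iff) (simp add: case_prod_unfold)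
qed

lemma contraction_integrand_continuous:
  fixes S :: "real \<Rightarrow> 'a::banach \<Rightarrow> 'a"
  assumes S: "c0_semigroup S" and C: "\<And>t x. t \<ge> 0 \<Longrightarrow> norm (S t x) \<le> norm x"
    and u: "continuous_on {0..T} u" and "0 \<le> a" "b \<le> t" "b \<le> T"
  shows "continuous_on {a..b} (\<lambda>s. S (t - s) (u s))"
proof -
  have "continuous_on {a..b} (\<lambda>s. (\<lambda>(r, y). S r y) (t - s, u s))"
    by (rule continuous_on_compose2[OF contraction_jointly_continuous[OF S C]])
      (use assms in \<open>auto intro!: continuous_intros continuous_on_subset[OF u]\<close>)
  thus ?thesis by simp
qed

text \<open>
  Rescaling the integral to \<open>[0, 1]\<close> moves the dependence on \<open>t\<close> into the integrand, where it is
  jointly continuous, and the theorem on continuity of parameter integrals applies.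
\<close>

lemma contraction_mild_solution_continuous:
  fixes S :: "real \<Rightarrow> 'a::banach \<Rightarrow> 'a"
  assumes S: "c0_semigroup S" and C: "\<And>t x. t \<ge> 0 \<Longrightarrow> norm (S t x) \<le> norm x"
    and u: "continuous_on {0..T} u"
  shows "continuous_on {0..T} (mild_solution S id u)"
proof -
  let ?f = "\<lambda>t s. S (t - t * s) (u (t * s))"
  have ts: "t * s \<le> T" if "0 \<le> t" "t \<le> T" "0 \<le> s" "s \<le> 1" for t s :: real
    using mult_left_le[OF that(4,1)] that by linarith
  have "continuous_on ({0..T} \<times> cbox 0 1) (\<lambda>p. (\<lambda>(r, y). S r y) (fst p - fst p * snd p, u (fst p * snd p)))"
    by (rule continuous_on_compose2[OF contraction_jointly_continuous[OF S C]])
      (auto intro!: continuous_intros continuous_on_compose2[OF u] ts simp: mult_left_le)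
  hence "continuous_on ({0..T} \<times> cbox 0 1) (\<lambda>(t, s). ?f t s)"
    by (simp add: case_prod_unfold)
  from integral_continuous_on_param[OF this]
  have cont: "continuous_on {0..T} (\<lambda>t. t *\<^sub>R integral {0..1} (?f t))"
    by (auto intro!: continuous_intros)
  have scaled: "mild_solution S id u t = t *\<^sub>R integral {0..1} (?f t)" if t: "t \<in> {0..T}" for t
  proof (cases "t = 0")
    case False
    with t have t0: "t > 0" by simp
    have "((\<lambda>s. S (t - s) (u s)) has_integral mild_solution S id u t) {0..t}"
      unfolding mild_solution_def
      using integrable_continuous_real[OF contraction_integrand_continuous[OF S C u, of 0 t t]] t
      by (simp add: integrable_integral)
    from has_integral_affinity[of _ _ 0 t, OF this[unfolded box_real(2)[symmetric]], of t 0] t0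
    have "(?f t has_integral (mild_solution S id u t /\<^sub>R t)) {0..1}"
      by (simp add: inverse_eq_divide)
    thus ?thesis using t0 by (simp add: integral_unique)
  qed (simp add: mild_solution_def)
  show ?thesis
  proof (rule continuous_on_eq[OF cont])
    fix t assume "t \<in> {0..T}"
    thus "t *\<^sub>R integral {0..1} (?f t) = mild_solution S id u t" by (rule scaled[symmetric])
  qed
qed

text \<open>
  On the short interval \<open>[t, t + h]\<close> both \<open>t + h - s\<close> is close to \<open>0\<close> and \<open>s\<close> is close to \<open>t\<close>,
  so joint continuity puts the integrand close to \<open>S 0 (u t) = u t\<close>.
\<close>

lemma contraction_step_average_tendsto:
  fixes S :: "real \<Rightarrow> 'a::banach \<Rightarrow> 'a"
  assumes S: "c0_semigroup S" and C: "\<And>t x. t \<ge> 0 \<Longrightarrow> norm (S t x) \<le> norm x"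
    and u: "continuous_on {0..T} u" and t: "0 \<le> t" "t < T"
  shows "((\<lambda>h. integral {t..t+h} (\<lambda>s. S (t + h - s) (u s)) /\<^sub>R h) \<longlongrightarrow> u t) (at_right 0)"
proof (rule average_tendsto_if_near)
  show "\<forall>\<^sub>F h in at_right 0. (\<lambda>s. S (t + h - s) (u s)) integrable_on {t..t+h}"
    using eventually_at_right_0_less[of "T - t"] t
    by (auto elim!: eventually_mono
        intro!: integrable_continuous_real contraction_integrand_continuous[OF S C u])
  fix e :: real assume e: "e > 0"
  have "continuous_on ({0..} \<times> {0..T}) (\<lambda>p. (\<lambda>(r, y). S r y) (fst p, u (snd p)))"
    by (rule continuous_on_compose2[OF contraction_jointly_continuous[OF S C]])
      (auto intro!: continuous_intros continuous_on_compose2[OF u])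
  moreover have "(0::real, t) \<in> {0..} \<times> {0..T}" using t by simp
  ultimately obtain d where d: "d > 0"
      "\<And>p. p \<in> {0..} \<times> {0..T} \<Longrightarrow> dist p (0, t) < d \<Longrightarrow> dist (S (fst p) (u (snd p))) (S 0 (u t)) < e"
    using e unfolding continuous_on_iff by fastforce
  have "\<forall>\<^sub>F h in at_right 0. h < d / 2" "\<forall>\<^sub>F h in at_right 0. h < T - t"
    by (rule eventually_at_right_0_less, use d(1) t in simp)+
  thus "\<forall>\<^sub>F h in at_right 0. \<forall>s\<in>{t..t+h}. norm (S (t + h - s) (u s) - u t) \<le> e"
  proof (eventually_elim, intro ballI)
    case (elim h)
    fix s assume s: "s \<in> {t..t+h}"
    have "dist (t + h - s, s) (0, t) \<le> \<bar>t + h - s\<bar> + \<bar>s - t\<bar>"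
      unfolding dist_Pair_Pair dist_real_def using sqrt_sum_squares_le_sum_abs[of "t + h - s - 0" "s - t"] by simp
    also have "\<dots> < d" using s elim by auto
    finally have "dist (S (t + h - s) (u s)) (S 0 (u t)) < e"
      using d(2)[of "(t + h - s, s)"] s elim t by auto
    thus "norm (S (t + h - s) (u s) - u t) \<le> e" by (simp add: dist_norm c0_zero[OF S])
  qed
qed

lemma contraction_mild_solution_step:
  fixes S :: "real \<Rightarrow> 'a::banach \<Rightarrow> 'a"
  assumes S: "c0_semigroup S" and C: "\<And>t x. t \<ge> 0 \<Longrightarrow> norm (S t x) \<le> norm x"
    and u: "continuous_on {0..T} u" and t: "0 \<le> t" "0 \<le> h" "t + h \<le> T"
  shows "mild_solution S id u (t + h) =
    S h (mild_solution S id u t) + integral {t..t+h} (\<lambda>s. S (t + h - s) (u s))"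
proof -
  note int = integrable_continuous_real[OF contraction_integrand_continuous[OF S C u]]
  interpret bounded_linear "S h" by (rule c0_linear[OF S t(2)])
  have "S h (mild_solution S id u t) = integral {0..t} (S h \<circ> (\<lambda>s. S (t - s) (u s)))"
    unfolding mild_solution_def id_def
    by (rule integral_linear[symmetric]) (use int t bounded_linear_axioms in auto)
  also have "\<dots> = integral {0..t} (\<lambda>s. S (t + h - s) (u s))"
    by (rule integral_cong) (use t in \<open>simp add: c0_add[OF S, symmetric] algebra_simps\<close>)
  finally show ?thesis unfolding mild_solution_def id_def
    using Henstock_Kurzweil_Integration.integral_combine[of 0 t "t + h" "\<lambda>s. S (t + h - s) (u s)"] int t by auto
qed

text \<open>
  The function \<open>\<parallel>x(t)\<parallel>\<^sup>2 - 2 W\<^sub>t\<close> vanishes at \<open>0\<close> and has nonpositive upper right Dini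
  derivative: in a step of length \<open>h\<close>, contractivity discards the change from \<open>x(t)\<close> to \<open>S(h) x(t)\<close>,
  and the mixed term of the square is \<open>2 h \<langle>x(t), u(t)\<rangle>\<close> up to \<open>o(h)\<close>.
\<close>

lemma contraction_energy_inequality:
  fixes S :: "real \<Rightarrow> 'a::{real_inner,banach} \<Rightarrow> 'a"
  assumes S: "c0_semigroup S" and C: "\<And>t x. t \<ge> 0 \<Longrightarrow> norm (S t x) \<le> norm x"
    and T: "0 \<le> T" and u: "continuous_on {0..T} u"
  shows "(norm (mild_solution S id u T))\<^sup>2 \<le> 2 * integral {0..T} (\<lambda>t. mild_solution S id u t \<bullet> u t)"
proof -
  define x where "x = mild_solution S id u"
  have x: "continuous_on {0..T} x"
    unfolding x_def by (rule contraction_mild_solution_continuous[OF S C u])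
  have xu: "continuous_on {0..T} (\<lambda>t. x t \<bullet> u t)" by (intro continuous_intros x u)
  define W where "W t = integral {0..t} (\<lambda>t. x t \<bullet> u t)" for t
  define f where "f t = x t \<bullet> x t - 2 * W t" for t
  have Wd: "(W has_vector_derivative x t \<bullet> u t) (at t within {0..T})" if "t \<in> {0..T}" for t
    unfolding W_def by (rule integral_has_vector_derivative[OF xu that])
  have "f T \<le> f 0"
  proof (rule nonincreasing_if_upper_right_derivative_nonpos[OF T])
    have "continuous_on {0..T} W"
      unfolding continuous_on_eq_continuous_within
      by (intro ballI) (rule has_vector_derivative_continuous[OF Wd])
    thus "continuous_on {0..T} f" unfolding f_def by (intro continuous_intros x)
    fix t assume t: "0 \<le> t" "t < T"
    define q where "q h = integral {t..t+h} (\<lambda>s. S (t + h - s) (u s)) /\<^sub>R h" for h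
    have q: "(q \<longlongrightarrow> u t) (at_right 0)"
      unfolding q_def by (rule contraction_step_average_tendsto[OF S C u t])
    define w where "w h = (W (t + h) - W t) /\<^sub>R h" for h
    have W_step: "W (t + h) - W t = integral {t..t+h} (\<lambda>t. x t \<bullet> u t)" if "0 \<le> h" "h < T - t" for h
      using Henstock_Kurzweil_Integration.integral_combine[of 0 t "t + h" "\<lambda>t. x t \<bullet> u t"] that t
        integrable_continuous_real[OF continuous_on_subset[OF xu, of "{0..t+h}"]]
      by (simp add: W_def)
    have small: "\<forall>\<^sub>F h in at_right 0. h < T - t"
      using t by (intro eventually_at_right_0_less) simp
    have w: "(w \<longlongrightarrow> x t \<bullet> u t) (at_right 0)"
    proof (rule Lim_transform_eventually[OF average_tendsto[OF xu t]])
      show "\<forall>\<^sub>F h in at_right 0. integral {t..t+h} (\<lambda>t. x t \<bullet> u t) /\<^sub>R h = w h"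
        using small eventually_at_right_less[of 0] by eventually_elim (simp add: w_def W_step)
    qed
    define d where "d h = 2 * (S h (x t) \<bullet> q h) + h * (q h \<bullet> q h) - 2 * w h" for h
    have "(d \<longlongrightarrow> 2 * (x t \<bullet> u t) + 0 * (u t \<bullet> u t) - 2 * (x t \<bullet> u t)) (at_right 0)"
      unfolding d_def by (intro tendsto_intros q w orbit_tendsto_at_0[OF S])
    moreover have "\<forall>\<^sub>F h in at_right 0. f (t + h) \<le> f t + h * d h"
      using small eventually_at_right_less[of 0]
    proof eventually_elim
      case (elim h)
      have "x (t + h) = S h (x t) + h *\<^sub>R q h"
        using contraction_mild_solution_step[OF S C u t(1), of h] elim by (simp add: x_def q_def)
      hence "x (t + h) \<bullet> x (t + h) = S h (x t) \<bullet> S h (x t) + h * (2 * (S h (x t) \<bullet> q h) + h * (q h \<bullet> q h))"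
        by (simp add: inner_add_left inner_add_right inner_commute algebra_simps)
      moreover have "S h (x t) \<bullet> S h (x t) \<le> x t \<bullet> x t"
        using C[of h "x t"] elim by (simp add: norm_le)
      moreover have "W (t + h) = W t + h * w h" using elim by (simp add: w_def flip: mult.assoc)
      ultimately show ?case by (simp add: f_def d_def algebra_simps)
    qed
    ultimately show "\<exists>d q. d \<le> 0 \<and> (q \<longlongrightarrow> d) (at_right 0) \<and> (\<forall>\<^sub>F h in at_right 0. f (t + h) \<le> f t + h * q h)"
      by (intro exI[of _ 0] exI[of _ d]) simp
  qed
  thus ?thesis by (simp add: f_def W_def x_def mild_solution_def power2_norm_eq_inner)
qed

section \<open>Complex inner products\<close>

lemma norm_scaleC: "norm (scaleC a x) = cmod a * norm (x :: 'a::complex_inner)"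
proof -
  have "cinner (scaleC a x) (scaleC a x) = a * cnj (a * cinner x x)"
    by (metis cinner_commute cinner_scaleC_left)
  also have "cnj (cinner x x) = cinner x x" by (metis cinner_commute)
  hence "a * cnj (a * cinner x x) = complex_of_real ((cmod a)\<^sup>2) * cinner x x"
    unfolding complex_norm_square by (simp add: mult.assoc)
  finally have "(norm (scaleC a x))\<^sup>2 = (cmod a * norm x)\<^sup>2"
    by (simp add: power2_norm_eq_inner inner_eq_Re_cinner power_mult_distrib)
  thus ?thesis by simp
qed

lemma bounded_linear_scaleC: "bounded_linear (scaleC a :: 'a::complex_inner \<Rightarrow> 'a)"
  by (rule bounded_linear_intro[of _ "cmod a"])
    (simp_all add: scaleC_add_right scaleR_eq_scaleC scaleC_scaleC norm_scaleC mult.commute)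

text \<open>
  The imaginary part is a real inner product too, since \<open>Im z = Re (-\<i> z)\<close>.  Continuity of the
  complex inner product is thereby inherited from the real one.
\<close>

lemma cinner_eq_inner:
  "cinner x y = Complex (x \<bullet> y) (scaleC (- \<i>) x \<bullet> (y :: 'a::complex_inner))"
  by (simp add: complex_eq_iff inner_eq_Re_cinner cinner_scaleC_left)

text \<open>
  The real part commutes with the integral only because the integrand is integrable, which is where
  the continuity of both functions enters.
\<close>

lemma Re_integral_cinner:
  fixes f g :: "real \<Rightarrow> 'a::complex_inner"
  assumes f: "continuous_on {a..b} f" and g: "continuous_on {a..b} g"
  shows "Re (integral {a..b} (\<lambda>t. cinner (f t) (g t))) = integral {a..b} (\<lambda>t. f t \<bullet> g t)"
proof -
  have "continuous_on {a..b} (\<lambda>t. cinner (f t) (g t))"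
    unfolding cinner_eq_inner
    by (intro continuous_intros f g bounded_linear.continuous_on[OF bounded_linear_scaleC])
  hence "(\<lambda>t. cinner (f t) (g t)) integrable_on {a..b}" by (rule integrable_continuous_real)
  from integral_linear[OF this bounded_linear_Re] show ?thesis
    by (simp add: o_def inner_eq_Re_cinner)
qed

theorem theorem15:
  fixes D :: "'a::{real_inner,banach} set" and A :: "'a \<Rightarrow> 'a"
    and E :: "'b::complex_hilbert_space set" and B :: "'b \<Rightarrow> 'b"
  shows "((\<exists>S. c0_semigroup S \<and> is_generator S D A) \<longrightarrow>
            (locally_passive D A id \<longleftrightarrow> dissipative D A)) \<and>
         ((\<exists>S. complex_c0_semigroup S \<and> is_generator S E B) \<longrightarrow>
            (complex_locally_passive E B id \<longleftrightarrow> complex_dissipative E B))"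
proof (intro conjI impI)
  assume "\<exists>S. c0_semigroup S \<and> is_generator S D A"
  then obtain S where S: "c0_semigroup S" and G: "is_generator S D A" by auto
  show "locally_passive D A id \<longleftrightarrow> dissipative D A"
  proof
    assume P: "locally_passive D A id"
    show "dissipative D A" unfolding dissipative_def
    proof
      fix v assume v: "v \<in> D"
      let ?u = "\<lambda>s. (1 - 2 * s) *\<^sub>R v - (s * (1 - s)) *\<^sub>R A v"
      have "continuous_on {0..1} ?u" by (intro continuous_intros)
      hence "integral {0..1} (\<lambda>t. mild_solution S id ?u t \<bullet> id (?u t)) \<ge> 0"
        using P[unfolded locally_passive_def, rule_format, OF conjI[OF S G] zero_less_one] by blast
      thus "A v \<bullet> v \<le> 0" unfolding bump_energy[OF S G v] by simp
    qed
  next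
    assume diss: "dissipative D A"
    show "locally_passive D A id" unfolding locally_passive_def
    proof (intro allI impI, elim conjE)
      fix S :: "real \<Rightarrow> 'a \<Rightarrow> 'a" and T :: real and u :: "real \<Rightarrow> 'a"
      assume S: "c0_semigroup S" and G: "is_generator S D A" and T: "T > 0" and u: "continuous_on {0..T} u"
      show "integral {0..T} (\<lambda>t. mild_solution S id u t \<bullet> id (u t)) \<ge> 0"
        using order_trans[OF zero_le_power2
          contraction_energy_inequality[OF S dissipative_imp_contraction[OF S G diss] less_imp_le[OF T] u]]
        by simp
    qed
  qed
next
  assume "\<exists>S. complex_c0_semigroup S \<and> is_generator S E B"
  then obtain S where S': "complex_c0_semigroup S" and G: "is_generator S E B" by auto
  have S: "c0_semigroup S" using S' by (simp add: complex_c0_semigroup_def)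
  have diss_iff: "complex_dissipative E B \<longleftrightarrow> dissipative E B"
    by (simp add: complex_dissipative_def dissipative_def inner_eq_Re_cinner)
  show "complex_locally_passive E B id \<longleftrightarrow> complex_dissipative E B"
    unfolding diss_iff
  proof
    assume P: "complex_locally_passive E B id"
    show "dissipative E B" unfolding dissipative_def
    proof
      fix v assume v: "v \<in> E"
      let ?u = "\<lambda>s. (1 - 2 * s) *\<^sub>R v - (s * (1 - s)) *\<^sub>R B v"
      have u: "continuous_on {0..1} ?u" by (intro continuous_intros)
      have "continuous_on {0..1} (\<lambda>t. (t * (1 - t)) *\<^sub>R v)" by (intro continuous_intros)
      hence x: "continuous_on {0..1} (mild_solution S id ?u)"
        by (rule continuous_on_eq) (simp add: mild_solution_bump[OF S G v])
      have "Re (integral {0..1} (\<lambda>t. cinner (mild_solution S id ?u t) (id (?u t)))) \<ge> 0"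
        by (rule P[unfolded complex_locally_passive_def, rule_format, OF conjI[OF S' G] zero_less_one u])
      hence "integral {0..1} (\<lambda>t. mild_solution S id ?u t \<bullet> id (?u t)) \<ge> 0"
        using Re_integral_cinner[OF x u] by simp
      thus "B v \<bullet> v \<le> 0" unfolding bump_energy[OF S G v] by simp
    qed
  next
    assume diss: "dissipative E B"
    show "complex_locally_passive E B id" unfolding complex_locally_passive_def
    proof (intro allI impI, elim conjE)
      fix S :: "real \<Rightarrow> 'b \<Rightarrow> 'b" and T :: real and u :: "real \<Rightarrow> 'b"
      assume S': "complex_c0_semigroup S" and G: "is_generator S E B" and T: "T > 0" and u: "continuous_on {0..T} u"
      have S: "c0_semigroup S" using S' by (simp add: complex_c0_semigroup_def)
      note C = dissipative_imp_contraction[OF S G diss]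
      show "Re (integral {0..T} (\<lambda>t. cinner (mild_solution S id u t) (id (u t)))) \<ge> 0"
        using order_trans[OF zero_le_power2 contraction_energy_inequality[OF S C less_imp_le[OF T] u]]
          Re_integral_cinner[OF contraction_mild_solution_continuous[OF S C u] u] by simp
    qed
  qed
qed

end
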